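(* Let $G$ be a graph with $n^2$ vertices and $H$ a graph with $m^2$ vertices, where $n\geq m$. If $O\chi(G)=n$, then $O\chi(G\,\square\, H)=nm$.
   Context: The Cartesian product $G\square H$ has vertex set $V(G)\times V(H)$, with $(u_1,v_1)$ adjacent to $(u_2,v_2)$ iff either $u_1=u_2$ and $v_1v_2\in E(H)$, or $v_1=v_2$ and $u_1u_2\in E(G)$. All colourings are proper vertex colourings. Two colourings are orthogonal if whenever two distinct vertices receive the same colour in one, they receive distinct colours in the other. An orthogonal colouring is a pair of orthogonal proper colourings; $O\chi(G)$ is the minimum number of colours needed for an orthogonal colouring of $G$ (both colourings drawing from the same set of that many colours). *)

theory Defs
  imports "Graph_Theory.Pair_Digraph"
begin

text \<open>
  A finite simple graph is a \<^locale>\<open>pair_graph\<close>: every undirected edge $uv$ is represented by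
  the two arcs $(u,v)$ and $(v,u)$.
\<close>

definition cartesian_product ::
  "'a pair_pre_digraph \<Rightarrow> 'b pair_pre_digraph \<Rightarrow> ('a \<times> 'b) pair_pre_digraph" (infixr "\<box>" 75)
where
  "G \<box> H = \<lparr> pverts = pverts G \<times> pverts H,
             parcs = {((u1, v1), (u2, v2)) | u1 v1 u2 v2.
               u1 \<in> pverts G \<and> u2 \<in> pverts G \<and> v1 \<in> pverts H \<and> v2 \<in> pverts H \<and>
               (u1 = u2 \<and> (v1, v2) \<in> parcs H \<or> v1 = v2 \<and> (u1, u2) \<in> parcs G)} \<rparr>"

definition proper_colouring :: "'a pair_pre_digraph \<Rightarrow> nat \<Rightarrow> ('a \<Rightarrow> nat) \<Rightarrow> bool" where
  "proper_colouring G k c \<longleftrightarrow>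
     (\<forall>v \<in> pverts G. c v < k) \<and> (\<forall>(u, v) \<in> parcs G. c u \<noteq> c v)"

definition orthogonal :: "'a pair_pre_digraph \<Rightarrow> ('a \<Rightarrow> nat) \<Rightarrow> ('a \<Rightarrow> nat) \<Rightarrow> bool" where
  "orthogonal G c d \<longleftrightarrow>
     (\<forall>u \<in> pverts G. \<forall>v \<in> pverts G. u \<noteq> v \<longrightarrow>
        (c u = c v \<longrightarrow> d u \<noteq> d v) \<and> (d u = d v \<longrightarrow> c u \<noteq> c v))"

definition orthogonal_colouring ::
  "'a pair_pre_digraph \<Rightarrow> nat \<Rightarrow> ('a \<Rightarrow> nat) \<Rightarrow> ('a \<Rightarrow> nat) \<Rightarrow> bool" where
  "orthogonal_colouring G k c d \<longleftrightarrow>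
     proper_colouring G k c \<and> proper_colouring G k d \<and> orthogonal G c d"

definition orthogonal_chromatic_number :: "'a pair_pre_digraph \<Rightarrow> nat" where
  "orthogonal_chromatic_number G = (LEAST k. \<exists>c d. orthogonal_colouring G k c d)"

lemma pair_graph_cartesian_product:
  assumes "pair_graph G" "pair_graph H"
  shows "pair_graph (G \<box> H)"
proof -
  interpret G: pair_graph G by fact
  interpret H: pair_graph H by fact
  let ?A = "parcs (G \<box> H)" and ?V = "pverts (G \<box> H)"
  have fin: "finite ?V"
    by (simp add: cartesian_product_def G.pair_finite_verts H.pair_finite_verts)
  have sub: "?A \<subseteq> ?V \<times> ?V"
    by (auto simp: cartesian_product_def)
  have "finite ?A"
    using fin sub by (meson finite_SigmaI finite_subset)
  moreover have "symmetric (G \<box> H)"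
    using G.pair_sym_arcs H.pair_sym_arcs
    by (auto simp: symmetric_def sym_def cartesian_product_def)
  moreover have "fst e \<noteq> snd e" if "e \<in> ?A" for e
    using that by (auto simp: cartesian_product_def dest: G.pair_no_loops H.pair_no_loops)
  ultimately show ?thesis
    using fin sub by unfold_locales auto
qed

text \<open>
  An injective colouring paired with itself is orthogonal, so the minimum defining
  \<^const>\<open>orthogonal_chromatic_number\<close> is attained for every finite graph.
\<close>

lemma orthogonal_colouring_exists:
  assumes "pair_graph G"
  shows "\<exists>c d. orthogonal_colouring G (card (pverts G)) c d"
proof -
  interpret pair_graph G by fact
  obtain c where c: "bij_betw c (pverts G) {0..<card (pverts G)}"
    using ex_bij_betw_finite_nat[OF pair_finite_verts] by blast
  have "c u \<noteq> c v" if "(u, v) \<in> parcs G" for u v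
    using that c pair_no_loops[OF that] wellformed'[OF that]
    by (auto simp: bij_betw_def inj_on_def)
  moreover have "c v < card (pverts G)" if "v \<in> pverts G" for v
    using bij_betwE[OF c] that by auto
  ultimately have "orthogonal_colouring G (card (pverts G)) c c"
    using bij_betw_imp_inj_on[OF c]
    by (auto simp: orthogonal_colouring_def proper_colouring_def orthogonal_def inj_on_def)
  then show ?thesis by blast
qed

lemma orthogonal_colouring_orthogonal_chromatic_number:
  assumes "pair_graph G"
  shows "\<exists>c d. orthogonal_colouring G (orthogonal_chromatic_number G) c d"
  unfolding orthogonal_chromatic_number_def
  by (rule LeastI) (rule orthogonal_colouring_exists[OF assms])

end

theory Submission
  imports Defs "HOL-Number_Theory.Cong"
begin

text \<open>
  Label the vertices of $H$ by pairs $(i,j) \in [m]^2$ and let $(c,d)$ be an orthogonal colouring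
  of $G$ with $n$ colours. Taking $[n] \times [m]$ as colour set, colour $(u,(i,j))$ by
  $(c(u)+j \bmod n,\, i)$ and $(d(u)+i \bmod n,\, j)$. Because $m \le n$, each colouring is injective
  on every copy of $H$, whatever the edges of $H$ are; on copies of $G$ it is a shift of $c$ or $d$;
  and the two colours together determine $i$ and $j$, hence $c(u)$ and $d(u)$, hence $u$.
  Conversely, $k$ colours can separate at most $k^2$ vertices.
\<close>

lemma add_mod_cancel_nat:
  fixes a b k n :: nat
  assumes "(a + k) mod n = (b + k) mod n" "a < n" "b < n"
  shows "a = b"
  using assms cong_add_rcancel_nat cong_less_modulus_unique_nat unfolding cong_def by blast

text \<open>Colours are natural numbers, so a pair in [n] x [m] is coded as \<open>a * m + i\<close>
  with low digit \<open>i\<close>. This bound keeps the code in the colour range, and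
  \<open>mult_add_eq_iff_nat\<close> makes it injective.\<close>

lemma mult_add_lt_nat:
  fixes a i m n :: nat
  assumes "a < n" "i < m"
  shows "a * m + i < n * m"
proof -
  have "a * m + i < Suc a * m" using assms by simp
  also have "\<dots> \<le> n * m" using assms by (intro mult_le_mono1) simp
  finally show ?thesis .
qed

lemma mult_add_eq_iff_nat:
  fixes a b i j m :: nat
  assumes "i < m" "j < m"
  shows "a * m + i = b * m + j \<longleftrightarrow> a = b \<and> i = j"
proof
  assume eq: "a * m + i = b * m + j"
  have "(a * m + i) div m = (b * m + j) div m" "(a * m + i) mod m = (b * m + j) mod m"
    using eq by simp_all
  then show "a = b \<and> i = j" using assms by simp
qed simp

text \<open>Orthogonality says that the pair of colours identifies a vertex, so the vertices embed
  into a \<open>k\<close> by \<open>k\<close> grid.\<close>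

lemma orthogonal_colouring_card_le:
  assumes "orthogonal_colouring G k c d"
  shows "card (pverts G) \<le> k\<^sup>2"
proof -
  have "inj_on (\<lambda>v. (c v, d v)) (pverts G)"
    using assms by (auto simp: orthogonal_colouring_def orthogonal_def inj_on_def)
  moreover have "(\<lambda>v. (c v, d v)) ` pverts G \<subseteq> {..<k} \<times> {..<k}"
    using assms by (auto simp: orthogonal_colouring_def proper_colouring_def)
  ultimately have "card (pverts G) \<le> card ({..<k} \<times> {..<k})"
    by (intro card_inj_on_le) auto
  then show ?thesis by (simp add: power2_eq_square)
qed

text \<open>The labels \<open>i\<close> and \<open>j\<close> are kept abstract so that the result
  yields both colourings of the product, the second one with the two labels exchanged.\<close>

lemma proper_colouring_shift_product:
  fixes c :: "'a \<Rightarrow> nat" and i j :: "'b \<Rightarrow> nat"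
  assumes "pair_graph H" "proper_colouring G n c" "m \<le> n"
    and i: "\<And>v. v \<in> pverts H \<Longrightarrow> i v < m" and j: "\<And>v. v \<in> pverts H \<Longrightarrow> j v < m"
    and inj: "inj_on (\<lambda>v. (i v, j v)) (pverts H)"
  shows "proper_colouring (G \<box> H) (n * m) (\<lambda>(u, v). (c u + j v) mod n * m + i v)"
proof -
  interpret H: pair_graph H by fact
  \<comment> \<open>The bound \<open>i v < m\<close> with \<open>m \<le> n\<close> makes
    \<open>n\<close> positive, so the remainder modulo \<open>n\<close> is below
    \<open>n\<close>.\<close>
  have lt: "(c u + j v) mod n * m + i v < n * m" if "u \<in> pverts G" "v \<in> pverts H" for u v
    using i[OF that(2)] assms(3) by (intro mult_add_lt_nat) auto
  have H_arc: "(c u + j v) mod n * m + i v \<noteq> (c u + j w) mod n * m + i w"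
    if vw: "(v, w) \<in> parcs H" "v \<in> pverts H" "w \<in> pverts H" for u v w
  proof
    assume "(c u + j v) mod n * m + i v = (c u + j w) mod n * m + i w"
    then have "(c u + j v) mod n = (c u + j w) mod n" and ii: "i v = i w"
      using i vw by (simp_all add: mult_add_eq_iff_nat)
    \<comment> \<open>Here \<open>c u\<close> is the common shift; since \<open>m \<le> n\<close>,
      labels below \<open>m\<close> are determined by their residues modulo
      \<open>n\<close>.\<close>
    then have "j v = j w"
      using add_mod_cancel_nat[of "j v" "c u" n "j w"] j[OF vw(2)] j[OF vw(3)] assms(3)
      by (simp add: add.commute)
    with ii inj vw have "v = w" by (auto simp: inj_on_def)
    then show False using H.pair_no_loops[OF vw(1)] by simp
  qed
  have G_arc: "(c u + j v) mod n * m + i v \<noteq> (c w + j v) mod n * m + i v"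
    if "(u, w) \<in> parcs G" "u \<in> pverts G" "w \<in> pverts G" "v \<in> pverts H" for u v w
  proof
    assume "(c u + j v) mod n * m + i v = (c w + j v) mod n * m + i v"
    then have "(c u + j v) mod n = (c w + j v) mod n"
      using mult_add_eq_iff_nat[OF i i] that(4) by blast
    then have "c u = c w"
      by (rule add_mod_cancel_nat) (use assms(2) that in \<open>simp_all add: proper_colouring_def\<close>)
    then show False using assms(2) that by (auto simp: proper_colouring_def)
  qed
  show ?thesis
    using lt H_arc G_arc by (auto simp: proper_colouring_def cartesian_product_def)
qed

lemma orthogonal_colouring_product:
  fixes G :: "'a pair_pre_digraph" and H :: "'b pair_pre_digraph"
  assumes "pair_graph H" "card (pverts H) = m\<^sup>2" "m \<le> n" "orthogonal_colouring G n c d"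
  shows "\<exists>c' d'. orthogonal_colouring (G \<box> H) (n * m) c' d'"
proof -
  interpret H: pair_graph H by fact
  obtain h where h: "bij_betw h (pverts H) {0..<m\<^sup>2}"
    using ex_bij_betw_finite_nat[OF H.pair_finite_verts] assms(2) by metis
  \<comment> \<open>The two base \<open>m\<close> digits of the number \<open>h v\<close> place the
    vertices of \<open>H\<close> on an \<open>m\<close> by \<open>m\<close> grid.\<close>
  define i where "i v = h v div m" for v
  define j where "j v = h v mod m" for v
  have h_lt: "h v < m * m" if "v \<in> pverts H" for v
    using bij_betwE[OF h] that by (auto simp: power2_eq_square)
  have i: "i v < m" if "v \<in> pverts H" for v
    using h_lt[OF that] by (simp add: i_def less_mult_imp_div_less)
  have j: "j v < m" if "v \<in> pverts H" for v
    using i[OF that] by (simp add: j_def)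
  have inj: "inj_on (\<lambda>v. (i v, j v)) (pverts H)"
  proof (rule inj_onI)
    fix v w assume "v \<in> pverts H" "w \<in> pverts H" "(i v, j v) = (i w, j w)"
    then show "v = w"
      using bij_betw_imp_inj_on[OF h] by (metis Pair_inject div_mult_mod_eq i_def inj_onD j_def)
  qed
  then have inj': "inj_on (\<lambda>v. (j v, i v)) (pverts H)"
    by (auto simp: inj_on_def)
  have c: "proper_colouring G n c" and d: "proper_colouring G n d" and o: "orthogonal G c d"
    using assms(4) by (auto simp: orthogonal_colouring_def)
  define c' where "c' = (\<lambda>(u, v). (c u + j v) mod n * m + i v)"
  define d' where "d' = (\<lambda>(u, v). (d u + i v) mod n * m + j v)"
  have "(u, v) = (u', v')"
    if V: "u \<in> pverts G" "v \<in> pverts H" "u' \<in> pverts G" "v' \<in> pverts H"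
      and eq: "c' (u, v) = c' (u', v')" "d' (u, v) = d' (u', v')" for u v u' v'
  proof -
    have cc: "(c u + j v) mod n = (c u' + j v') mod n" and ii: "i v = i v'"
      using eq(1) i V by (simp_all add: c'_def mult_add_eq_iff_nat)
    have dd: "(d u + i v) mod n = (d u' + i v') mod n" and jj: "j v = j v'"
      using eq(2) j V by (simp_all add: d'_def mult_add_eq_iff_nat)
    \<comment> \<open>The shift in each colouring is the low digit of the other one, so it is
      already known to agree and can be cancelled.\<close>
    have "c u = c u'"
      by (rule add_mod_cancel_nat[OF cc[folded jj]]) (use c V in \<open>simp_all add: proper_colouring_def\<close>)
    moreover have "d u = d u'"
      by (rule add_mod_cancel_nat[OF dd[folded ii]]) (use d V in \<open>simp_all add: proper_colouring_def\<close>)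
    ultimately have "u = u'" using o V by (auto simp: orthogonal_def)
    moreover have "v = v'" using ii jj inj V by (auto simp: inj_on_def)
    ultimately show ?thesis by simp
  qed
  then have "orthogonal (G \<box> H) c' d'"
    by (auto simp: orthogonal_def cartesian_product_def)
  moreover have "proper_colouring (G \<box> H) (n * m) c'"
    unfolding c'_def by (rule proper_colouring_shift_product) (use assms c i j inj in auto)
  moreover have "proper_colouring (G \<box> H) (n * m) d'"
    unfolding d'_def by (rule proper_colouring_shift_product) (use assms d i j inj' in auto)
  ultimately show ?thesis by (auto simp: orthogonal_colouring_def)
qed

theorem theorem13:
  fixes G :: "'a pair_pre_digraph" and H :: "'b pair_pre_digraph" and n m :: nat
  assumes "pair_graph G" and "pair_graph H"
    and "card (pverts G) = n\<^sup>2" and "card (pverts H) = m\<^sup>2"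
    and "n \<ge> m"
    and "orthogonal_chromatic_number G = n"
  shows "orthogonal_chromatic_number (G \<box> H) = n * m"
  unfolding orthogonal_chromatic_number_def
proof (rule Least_equality)
  show "\<exists>c d. orthogonal_colouring (G \<box> H) (n * m) c d"
    using orthogonal_colouring_orthogonal_chromatic_number[OF assms(1)]
      orthogonal_colouring_product[OF assms(2,4,5)] assms(6) by auto
next
  fix k assume "\<exists>c d. orthogonal_colouring (G \<box> H) k c d"
  then have "card (pverts (G \<box> H)) \<le> k\<^sup>2"
    using orthogonal_colouring_card_le by blast
  \<comment> \<open>The product has exactly \<open>(n * m)\<^sup>2\<close> vertices, so the counting
    bound meets the construction.\<close>
  then have "(n * m)\<^sup>2 \<le> k\<^sup>2"
    using assms(3,4) by (simp add: cartesian_product_def card_cartesian_product power_mult_distrib)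
  then show "n * m \<le> k" by (simp add: power2_nat_le_eq_le)
qed

end
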